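(* Let $(A,\mu,\alpha,\beta)$ be a regular BiHom-associative algebra and let $(V,\rho_1,\rho_2,\phi,\psi)$ be a BiHom-associative $A$-bimodule (with left structure map $\rho_1$ and right structure map $\rho_2$) such that $\phi$ and $\psi$ are invertible. Let $A^+=(A,\mu',\alpha,\beta)$ with $\mu'(x,y)=\mu(x,y)+\mu(\alpha^{-1}\beta(y),\beta^{-1}\alpha(x))$. Then $(V,\rho_l,\rho_r,\phi,\psi)$ is a BiHom-Jordan $A^+$-bimodule, where for $x\in A$, $v\in V$ $$\rho_l(x,v)=\rho_1(x,v)+\rho_2(\psi\phi^{-1}(v),\alpha\beta^{-1}(x)),\qquad \rho_r(v,x)=\rho_1(\beta\alpha^{-1}(x),\phi\psi^{-1}(v))+\rho_2(v,x).$$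
   Context: $\mathbb{K}$ is an algebraically closed field of characteristic $0$; all vector spaces and (multi)linear maps are over $\mathbb{K}$. $\circlearrowleft_{(x,y,z)}$ denotes the sum over cyclic permutations of $x,y,z$. A BiHom-algebra $(A,\mu,\alpha,\beta)$ is a vector space $A$ with a bilinear map $\mu:A\times A\to A$ and linear maps $\alpha,\beta:A\to A$ with $\alpha\beta=\beta\alpha$. It is multiplicative if $\alpha(\mu(x,y))=\mu(\alpha(x),\alpha(y))$ and $\beta(\mu(x,y))=\mu(\beta(x),\beta(y))$ for all $x,y$. It is regular if $\alpha,\beta$ are algebra automorphisms. Its BiHom-associator is $as_{\alpha,\beta}(x,y,z)=\mu(\mu(x,y),\beta(z))-\mu(\alpha(x),\mu(y,z))$. A BiHom-associative algebra is a multiplicative BiHom-algebra with $as_{\alpha,\beta}=0$. A BiHom-Jordan algebra is a multiplicative BiHom-algebra with $\mu(\beta(x),\alpha(y))=\mu(\beta(y),\alpha(x))$ and $as_{\alpha,\beta}(\mu(\beta^2(x),\alpha\beta(x)),\alpha^2\beta(y),\alpha^3(x))=0$ for all $x,y$. For a regular BiHom-associative algebra $A$, $A^+$ is a BiHom-Jordan algebra. A BiHom-module $(V,\phi,\psi)$ is a vector space with commuting linear self-maps $\phi,\psi$. A left structure map is a linear map $\rho_l:A\otimes V\to V$ with $\phi\rho_l=\rho_l(\alpha\otimes\phi)$, $\psi\rho_l=\rho_l(\beta\otimes\psi)$; a right structure map is a linear map $\rho_r:V\otimes A\to V$ with $\phi\rho_r=\rho_r(\phi\otimes\alpha)$, $\psi\rho_r=\rho_r(\psi\otimes\beta)$.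 A BiHom-associative $A$-bimodule is a BiHom-module $(V,\phi,\psi)$ with left and right structure maps $\rho_1,\rho_2$ satisfying $\rho_1\circ(\alpha\otimes\rho_1)=\rho_1\circ(\mu\otimes\psi)$, $\rho_2\circ(\phi\otimes\mu)=\rho_2\circ(\rho_2\otimes\beta)$ and $\rho_1\circ(\alpha\otimes\rho_2)=\rho_2\circ(\rho_1\otimes\beta)$. For a BiHom-algebra $(J,\mu,\alpha,\beta)$ and left and right structure maps $\rho_l,\rho_r$ on $V$, the module BiHom-associator $as_V$ is, for $x,y\in J$, $v\in V$: $as_V(v,x,y)=\rho_r(\rho_r(v,x),\beta(y))-\rho_r(\phi(v),\mu(x,y))$, $as_V(x,v,y)=\rho_r(\rho_l(x,v),\beta(y))-\rho_l(\alpha(x),\rho_r(v,y))$, $as_V(x,y,v)=\rho_l(\mu(x,y),\psi(v))-\rho_l(\alpha(x),\rho_l(y,v))$. A BiHom-Jordan $J$-bimodule over a BiHom-Jordan algebra $(J,\mu,\alpha,\beta)$ is a BiHom-module $(V,\phi,\psi)$ with left and right structure maps $\rho_l,\rho_r$ such that for all $x,y,z\in J$, $v\in V$: $\rho_l(\beta(x),\phi(v))=\rho_r(\psi(v),\alpha(x))$; $\circlearrowleft_{(x,y,z)}as_V(\mu(\beta^2(x),\alpha\beta(y)),\phi^2\psi(v),\alpha^3(z))=0$; and $as_V(\rho_r(\psi^2(v),\beta\alpha(x)),\beta\alpha^2(y),\alpha^3(z))+as_V(\rho_r(\psi^2(v),\beta\alpha(z)),\beta\alpha^2(y),\alpha^3(x))+as_V(\mu(\beta^2(x),\beta\alpha(z)),\beta\alpha^2(y),\phi^3(v))=0$.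 *)

theory Defs
  imports Complex_Main "HOL-Computational_Algebra.Polynomial"
begin

text \<open>
  A vector space is a whole type of class \<open>ab_group_add\<close> together with a scalar multiplication
  satisfying the locale \<open>vector_space\<close>. A linear map out of a tensor product, such as
  \<open>A \<otimes> V \<rightarrow> V\<close>, is represented by the corresponding (curried) bilinear map.
\<close>

definition bilinear_map ::
  "('k::field \<Rightarrow> 'a::ab_group_add \<Rightarrow> 'a) \<Rightarrow> ('k \<Rightarrow> 'b::ab_group_add \<Rightarrow> 'b) \<Rightarrow>
   ('k \<Rightarrow> 'c::ab_group_add \<Rightarrow> 'c) \<Rightarrow> ('a \<Rightarrow> 'b \<Rightarrow> 'c) \<Rightarrow> bool" where
  "bilinear_map sa sb sc f \<longleftrightarrow>
     (\<forall>x. Vector_Spaces.linear sb sc (f x)) \<and> (\<forall>y. Vector_Spaces.linear sa sc (\<lambda>x. f x y))"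


section \<open>BiHom-algebras\<close>

locale bihom_algebra = vector_space sA
  for sA :: "'k::field \<Rightarrow> 'a::ab_group_add \<Rightarrow> 'a" +
  fixes mu :: "'a \<Rightarrow> 'a \<Rightarrow> 'a" and \<alpha> \<beta> :: "'a \<Rightarrow> 'a"
  assumes mu_bilinear: "bilinear_map sA sA sA mu"
    and alpha_linear: "Vector_Spaces.linear sA sA \<alpha>"
    and beta_linear: "Vector_Spaces.linear sA sA \<beta>"
    and alpha_beta_commute: "\<alpha> (\<beta> x) = \<beta> (\<alpha> x)"

locale multiplicative_bihom_algebra = bihom_algebra +
  assumes alpha_mult: "\<alpha> (mu x y) = mu (\<alpha> x) (\<alpha> y)"
    and beta_mult: "\<beta> (mu x y) = mu (\<beta> x) (\<beta> y)"

locale regular_bihom_algebra = multiplicative_bihom_algebra +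
  assumes alpha_bij: "bij \<alpha>"
    and beta_bij: "bij \<beta>"

definition bihom_associator ::
  "('a::ab_group_add \<Rightarrow> 'a \<Rightarrow> 'a) \<Rightarrow> ('a \<Rightarrow> 'a) \<Rightarrow> ('a \<Rightarrow> 'a) \<Rightarrow> 'a \<Rightarrow> 'a \<Rightarrow> 'a \<Rightarrow> 'a" where
  "bihom_associator mu \<alpha> \<beta> x y z = mu (mu x y) (\<beta> z) - mu (\<alpha> x) (mu y z)"

locale bihom_associative_algebra = multiplicative_bihom_algebra +
  assumes associator_zero: "bihom_associator mu \<alpha> \<beta> x y z = 0"

locale regular_bihom_associative_algebra =
  bihom_associative_algebra sA mu \<alpha> \<beta> + regular_bihom_algebra sA mu \<alpha> \<beta>
  for sA :: "'k::field \<Rightarrow> 'a::ab_group_add \<Rightarrow> 'a" and mu \<alpha> \<beta>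

locale bihom_jordan_algebra = multiplicative_bihom_algebra +
  assumes bihom_commutative: "mu (\<beta> x) (\<alpha> y) = mu (\<beta> y) (\<alpha> x)"
    and bihom_jordan_identity:
      "bihom_associator mu \<alpha> \<beta> (mu (\<beta> (\<beta> x)) (\<alpha> (\<beta> x))) (\<alpha> (\<alpha> (\<beta> y))) (\<alpha> (\<alpha> (\<alpha> x))) = 0"

text \<open>The multiplication of \<open>A\<^sup>+\<close>; it is only meaningful when \<open>\<alpha>\<close> and \<open>\<beta>\<close> are bijective.\<close>

definition plus_mult ::
  "('a::ab_group_add \<Rightarrow> 'a \<Rightarrow> 'a) \<Rightarrow> ('a \<Rightarrow> 'a) \<Rightarrow> ('a \<Rightarrow> 'a) \<Rightarrow> 'a \<Rightarrow> 'a \<Rightarrow> 'a" where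
  "plus_mult mu \<alpha> \<beta> x y = mu x y + mu (inv \<alpha> (\<beta> y)) (inv \<beta> (\<alpha> x))"


section \<open>BiHom-modules and bimodules\<close>

locale bihom_module = vector_space sV
  for sV :: "'k::field \<Rightarrow> 'v::ab_group_add \<Rightarrow> 'v" +
  fixes \<phi> \<psi> :: "'v \<Rightarrow> 'v"
  assumes phi_linear: "Vector_Spaces.linear sV sV \<phi>"
    and psi_linear: "Vector_Spaces.linear sV sV \<psi>"
    and phi_psi_commute: "\<phi> (\<psi> v) = \<psi> (\<phi> v)"

locale bihom_structure_maps =
  algebra: bihom_algebra sA mu \<alpha> \<beta> + module: bihom_module sV \<phi> \<psi>
  for sA :: "'k::field \<Rightarrow> 'a::ab_group_add \<Rightarrow> 'a" and mu \<alpha> \<beta>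
    and sV :: "'k \<Rightarrow> 'v::ab_group_add \<Rightarrow> 'v" and \<phi> \<psi> +
  fixes \<rho>l :: "'a \<Rightarrow> 'v \<Rightarrow> 'v" and \<rho>r :: "'v \<Rightarrow> 'a \<Rightarrow> 'v"
  assumes left_bilinear: "bilinear_map sA sV sV \<rho>l"
    and left_phi: "\<phi> (\<rho>l x v) = \<rho>l (\<alpha> x) (\<phi> v)"
    and left_psi: "\<psi> (\<rho>l x v) = \<rho>l (\<beta> x) (\<psi> v)"
    and right_bilinear: "bilinear_map sV sA sV \<rho>r"
    and right_phi: "\<phi> (\<rho>r v x) = \<rho>r (\<phi> v) (\<alpha> x)"
    and right_psi: "\<psi> (\<rho>r v x) = \<rho>r (\<psi> v) (\<beta> x)"

locale bihom_associative_bimodule =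
  algebra: bihom_associative_algebra sA mu \<alpha> \<beta> +
  bihom_structure_maps sA mu \<alpha> \<beta> sV \<phi> \<psi> \<rho>l \<rho>r
  for sA :: "'k::field \<Rightarrow> 'a::ab_group_add \<Rightarrow> 'a" and mu \<alpha> \<beta>
    and sV :: "'k \<Rightarrow> 'v::ab_group_add \<Rightarrow> 'v" and \<phi> \<psi> \<rho>l \<rho>r +
  assumes left_action: "\<rho>l (\<alpha> x) (\<rho>l y v) = \<rho>l (mu x y) (\<psi> v)"
    and right_action: "\<rho>r (\<phi> v) (mu x y) = \<rho>r (\<rho>r v x) (\<beta> y)"
    and actions_compatible: "\<rho>l (\<alpha> x) (\<rho>r v y) = \<rho>r (\<rho>l x v) (\<beta> y)"

text \<open>
  The module BiHom-associator \<open>as\<^sub>V\<close>, split according to whether the module element is in the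
  first, second or third slot.
\<close>

definition module_associator1 ::
  "('a \<Rightarrow> 'a \<Rightarrow> 'a) \<Rightarrow> ('a \<Rightarrow> 'a) \<Rightarrow> ('v \<Rightarrow> 'v) \<Rightarrow>
   ('v \<Rightarrow> 'a \<Rightarrow> 'v) \<Rightarrow> 'v::ab_group_add \<Rightarrow> 'a \<Rightarrow> 'a \<Rightarrow> 'v" where
  "module_associator1 mu \<beta> \<phi> \<rho>r v x y = \<rho>r (\<rho>r v x) (\<beta> y) - \<rho>r (\<phi> v) (mu x y)"

definition module_associator2 ::
  "('a \<Rightarrow> 'a) \<Rightarrow> ('a \<Rightarrow> 'a) \<Rightarrow> ('a \<Rightarrow> 'v \<Rightarrow> 'v) \<Rightarrow>
   ('v \<Rightarrow> 'a \<Rightarrow> 'v) \<Rightarrow> 'a \<Rightarrow> 'v::ab_group_add \<Rightarrow> 'a \<Rightarrow> 'v" where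
  "module_associator2 \<alpha> \<beta> \<rho>l \<rho>r x v y = \<rho>r (\<rho>l x v) (\<beta> y) - \<rho>l (\<alpha> x) (\<rho>r v y)"

definition module_associator3 ::
  "('a \<Rightarrow> 'a \<Rightarrow> 'a) \<Rightarrow> ('a \<Rightarrow> 'a) \<Rightarrow> ('v \<Rightarrow> 'v) \<Rightarrow>
   ('a \<Rightarrow> 'v \<Rightarrow> 'v) \<Rightarrow> 'a \<Rightarrow> 'a \<Rightarrow> 'v::ab_group_add \<Rightarrow> 'v" where
  "module_associator3 mu \<alpha> \<psi> \<rho>l x y v = \<rho>l (mu x y) (\<psi> v) - \<rho>l (\<alpha> x) (\<rho>l y v)"

definition cyclic_sum :: "('a \<Rightarrow> 'a \<Rightarrow> 'a \<Rightarrow> 'v::ab_group_add) \<Rightarrow> 'a \<Rightarrow> 'a \<Rightarrow> 'a \<Rightarrow> 'v" where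
  "cyclic_sum F x y z = F x y z + F y z x + F z x y"

locale bihom_jordan_bimodule =
  algebra: bihom_jordan_algebra sJ mu \<alpha> \<beta> +
  bihom_structure_maps sJ mu \<alpha> \<beta> sV \<phi> \<psi> \<rho>l \<rho>r
  for sJ :: "'k::field \<Rightarrow> 'a::ab_group_add \<Rightarrow> 'a" and mu \<alpha> \<beta>
    and sV :: "'k \<Rightarrow> 'v::ab_group_add \<Rightarrow> 'v" and \<phi> \<psi> \<rho>l \<rho>r +
  assumes actions_commute: "\<rho>l (\<beta> x) (\<phi> v) = \<rho>r (\<psi> v) (\<alpha> x)"
    and jordan_cyclic:
      "cyclic_sum (\<lambda>x y z. module_associator2 \<alpha> \<beta> \<rho>l \<rho>r
         (mu (\<beta> (\<beta> x)) (\<alpha> (\<beta> y))) (\<phi> (\<phi> (\<psi> v))) (\<alpha> (\<alpha> (\<alpha> z)))) x y z = 0"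
    and jordan_mixed:
      "module_associator1 mu \<beta> \<phi> \<rho>r
         (\<rho>r (\<psi> (\<psi> v)) (\<beta> (\<alpha> x))) (\<beta> (\<alpha> (\<alpha> y))) (\<alpha> (\<alpha> (\<alpha> z)))
       + module_associator1 mu \<beta> \<phi> \<rho>r
         (\<rho>r (\<psi> (\<psi> v)) (\<beta> (\<alpha> z))) (\<beta> (\<alpha> (\<alpha> y))) (\<alpha> (\<alpha> (\<alpha> x)))
       + module_associator3 mu \<alpha> \<psi> \<rho>l
         (mu (\<beta> (\<beta> x)) (\<beta> (\<alpha> z))) (\<beta> (\<alpha> (\<alpha> y))) (\<phi> (\<phi> (\<phi> v))) = 0"

end

theory Submission
  imports Defs
begin

text \<open>
  Untwisting the bimodule by the inverses of the structure maps turns \<open>A\<close> into an associative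
  algebra and \<open>V\<close> into an ordinary associative bimodule, on which \<open>\<alpha>, \<beta>, \<phi>, \<psi>\<close> act by
  automorphisms. In these terms \<open>\<mu>'(x, y) = {\<alpha> x, \<beta> y}\<close>, \<open>\<rho>\<^sub>l(x, v) = {\<alpha> x, \<psi> v}\<close> and
  \<open>\<rho>\<^sub>r(v, x) = {\<phi> v, \<beta> x}\<close> with the Jordan product \<open>{a, b} = a b + b a\<close>, so every BiHom-Jordan
  identity becomes the ordinary linearised Jordan identity evaluated at \<open>\<alpha>\<^sup>3\<beta>\<^sup>2 x\<close>, \<open>\<alpha>\<^sup>3\<beta>\<^sup>2 y\<close>,
  \<open>\<alpha>\<^sup>3\<beta>\<^sup>2 z\<close> and \<open>\<phi>\<^sup>3\<psi>\<^sup>2 v\<close>.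
\<close>

section \<open>The Jordan product on associative bimodules\<close>

text \<open>Plays the role of a bimodule over a possibly non-unital ring. The Jordan identities
  below are formal consequences of biadditivity and associativity.\<close>

locale associative_bimodule =
  fixes m :: "'a::ab_group_add \<Rightarrow> 'a \<Rightarrow> 'a"
    and l :: "'a \<Rightarrow> 'v::ab_group_add \<Rightarrow> 'v" and r :: "'v \<Rightarrow> 'a \<Rightarrow> 'v"
  assumes mult_add: "m (x + x') y = m x y + m x' y" "m x (y + y') = m x y + m x y'"
    and left_add: "l (x + x') v = l x v + l x' v" "l x (v + v') = l x v + l x v'"
    and right_add: "r (v + v') x = r v x + r v' x" "r v (x + x') = r v x + r v x'"
    and mult_assoc: "m (m x y) z = m x (m y z)"
    and left_assoc: "l (m x y) v = l x (l y v)"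
    and middle_assoc: "r (l x v) y = l x (r v y)"
    and right_assoc: "r v (m x y) = r (r v x) y"
begin

definition jordan_mult where "jordan_mult x y = m x y + m y x"

text \<open>A single symmetric action serves both sides: \<open>\<rho>l\<close> and
  \<open>\<rho>r\<close> turn out to differ only in the twists applied to their arguments.\<close>

definition jordan_act where "jordan_act x v = l x v + r v x"

lemmas expand = jordan_mult_def jordan_act_def mult_add left_add right_add
  mult_assoc left_assoc middle_assoc right_assoc

lemma jordan_mult_commute: "jordan_mult x y = jordan_mult y x"
  by (simp add: jordan_mult_def add.commute)

text \<open>With the commutator \<open>[a, b] = a b - b a\<close>, the Jordan associator of
  \<open>w\<close>, \<open>y\<close>, \<open>z\<close> is \<open>[y, [w, z]]\<close>. It vanishes
  for \<open>w = jordan_mult x x\<close> and \<open>z = x\<close>, because \<open>w\<close> is twice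
  the square of \<open>x\<close> and commutes with \<open>x\<close>.\<close>

lemma jordan_mult_identity:
  "jordan_mult (jordan_mult (jordan_mult x x) y) x = jordan_mult (jordan_mult x x) (jordan_mult y x)"
  by (simp add: expand algebra_simps)

text \<open>The commutator of the Jordan actions of \<open>a\<close> and \<open>b\<close> sends
  \<open>v\<close> to \<open>[[a, b], v]\<close>. The cyclic sum of
  \<open>[z, jordan_mult x y]\<close> is 0, since its twelve words cancel in pairs.\<close>

lemma jordan_act_cyclic:
  "jordan_act z (jordan_act (jordan_mult x y) v) - jordan_act (jordan_mult x y) (jordan_act z v)
   + (jordan_act x (jordan_act (jordan_mult y z) v) - jordan_act (jordan_mult y z) (jordan_act x v))
   + (jordan_act y (jordan_act (jordan_mult z x) v) - jordan_act (jordan_mult z x) (jordan_act y v))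
   = 0"
  by (simp add: expand algebra_simps)

text \<open>Each difference is a Jordan associator, hence of the form \<open>[y, [w, t]]\<close>.
  The three inner commutators form the cyclic sum of \<open>[{x, v}, z]\<close> over
  \<open>x\<close>, \<open>v\<close>, \<open>z\<close>, which vanishes by the same cancellation as
  in \<open>jordan_act_cyclic\<close>.\<close>

lemma jordan_act_mixed:
  "jordan_act z (jordan_act y (jordan_act x v)) - jordan_act (jordan_mult y z) (jordan_act x v)
   + (jordan_act x (jordan_act y (jordan_act z v)) - jordan_act (jordan_mult y x) (jordan_act z v))
   + (jordan_act (jordan_mult (jordan_mult x z) y) v - jordan_act (jordan_mult x z) (jordan_act y v))
   = 0"
  by (simp add: expand algebra_simps)

end

section \<open>Untwisting\<close>

lemma bilinear_map_iff:
  "bilinear_map sa sb sc f \<longleftrightarrow>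
     vector_space sa \<and> vector_space sb \<and> vector_space sc \<and>
     (\<forall>x x' y. f (x + x') y = f x y + f x' y) \<and> (\<forall>x y y'. f x (y + y') = f x y + f x y') \<and>
     (\<forall>c x y. f (sa c x) y = sc c (f x y)) \<and> (\<forall>c x y. f x (sb c y) = sc c (f x y))"
  unfolding bilinear_map_def Vector_Spaces.linear_iff by auto

lemma linear_inv_bij:
  assumes "Vector_Spaces.linear s t f" and "bij f"
  shows "Vector_Spaces.linear t s (inv f)"
proof -
  have "inv f y = x \<longleftrightarrow> y = f x" for x y
    using assms(2) by (metis bij_inv_eq_iff)
  then show ?thesis
    using assms unfolding Vector_Spaces.linear_iff
    by (metis bij_is_surj surj_f_inv_f)
qed

locale invertible_bihom_associative_bimodule =
  algebra: regular_bihom_associative_algebra sA mu \<alpha> \<beta> +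
  bihom_associative_bimodule sA mu \<alpha> \<beta> sV \<phi> \<psi> \<rho>1 \<rho>2
  for sA :: "'k::field \<Rightarrow> 'a::ab_group_add \<Rightarrow> 'a" and mu \<alpha> \<beta>
    and sV :: "'k \<Rightarrow> 'v::ab_group_add \<Rightarrow> 'v" and \<phi> \<psi> \<rho>1 \<rho>2 +
  assumes phi_bij: "bij \<phi>" and psi_bij: "bij \<psi>"
begin

lemma inv_cancel [simp]:
  "\<alpha> (inv \<alpha> x) = x" "inv \<alpha> (\<alpha> x) = x" "\<beta> (inv \<beta> x) = x" "inv \<beta> (\<beta> x) = x"
  "\<phi> (inv \<phi> v) = v" "inv \<phi> (\<phi> v) = v" "\<psi> (inv \<psi> v) = v" "inv \<psi> (\<psi> v) = v"
  using algebra.alpha_bij algebra.beta_bij phi_bij psi_bij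
  by (simp_all add: bij_is_surj surj_f_inv_f bij_is_inj)

text \<open>Oriented for rewriting: \<open>\<alpha>\<close> moves outside \<open>\<beta>\<close>,
  and each map moves outside the inverse of the other, so that equal words in the commuting maps
  reach a common shape. The same holds for \<open>\<phi>\<close> and \<open>\<psi>\<close>.\<close>

lemma commute:
  "\<beta> (\<alpha> x) = \<alpha> (\<beta> x)" "inv \<alpha> (\<beta> x) = \<beta> (inv \<alpha> x)" "inv \<beta> (\<alpha> x) = \<alpha> (inv \<beta> x)"
  "inv \<beta> (inv \<alpha> x) = inv \<alpha> (inv \<beta> x)"
  "\<psi> (\<phi> v) = \<phi> (\<psi> v)" "inv \<phi> (\<psi> v) = \<psi> (inv \<phi> v)" "inv \<psi> (\<phi> v) = \<phi> (inv \<psi> v)"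
  "inv \<psi> (inv \<phi> v) = inv \<phi> (inv \<psi> v)"
  by (metis algebra.alpha_beta_commute module.phi_psi_commute inv_cancel)+

lemma additive:
  "\<alpha> (x + y) = \<alpha> x + \<alpha> y" "\<beta> (x + y) = \<beta> x + \<beta> y"
  "inv \<alpha> (x + y) = inv \<alpha> x + inv \<alpha> y" "inv \<beta> (x + y) = inv \<beta> x + inv \<beta> y"
  "\<phi> (v + w) = \<phi> v + \<phi> w" "\<psi> (v + w) = \<psi> v + \<psi> w"
  "inv \<phi> (v + w) = inv \<phi> v + inv \<phi> w" "inv \<psi> (v + w) = inv \<psi> v + inv \<psi> w"
  using algebra.alpha_linear algebra.beta_linear module.phi_linear module.psi_linear
    linear_inv_bij[OF algebra.alpha_linear algebra.alpha_bij]
    linear_inv_bij[OF algebra.beta_linear algebra.beta_bij]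
    linear_inv_bij[OF module.phi_linear phi_bij] linear_inv_bij[OF module.psi_linear psi_bij]
  by (simp_all add: Vector_Spaces.linear_iff)

lemma homogeneous:
  "\<alpha> (sA c x) = sA c (\<alpha> x)" "\<beta> (sA c x) = sA c (\<beta> x)"
  "inv \<alpha> (sA c x) = sA c (inv \<alpha> x)" "inv \<beta> (sA c x) = sA c (inv \<beta> x)"
  "\<phi> (sV c v) = sV c (\<phi> v)" "\<psi> (sV c v) = sV c (\<psi> v)"
  "inv \<phi> (sV c v) = sV c (inv \<phi> v)" "inv \<psi> (sV c v) = sV c (inv \<psi> v)"
  using algebra.alpha_linear algebra.beta_linear module.phi_linear module.psi_linear
    linear_inv_bij[OF algebra.alpha_linear algebra.alpha_bij]
    linear_inv_bij[OF algebra.beta_linear algebra.beta_bij]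
    linear_inv_bij[OF module.phi_linear phi_bij] linear_inv_bij[OF module.psi_linear psi_bij]
  by (simp_all add: Vector_Spaces.linear_iff)

lemma bilinear:
  "mu (x + x') y = mu x y + mu x' y" "mu x (y + y') = mu x y + mu x y'"
  "mu (sA c x) y = sA c (mu x y)" "mu x (sA c y) = sA c (mu x y)"
  "\<rho>1 (x + x') v = \<rho>1 x v + \<rho>1 x' v" "\<rho>1 x (v + v') = \<rho>1 x v + \<rho>1 x v'"
  "\<rho>1 (sA c x) v = sV c (\<rho>1 x v)" "\<rho>1 x (sV c v) = sV c (\<rho>1 x v)"
  "\<rho>2 (v + v') x = \<rho>2 v x + \<rho>2 v' x" "\<rho>2 v (x + x') = \<rho>2 v x + \<rho>2 v x'"
  "\<rho>2 (sV c v) x = sV c (\<rho>2 v x)" "\<rho>2 v (sA c x) = sV c (\<rho>2 v x)"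
  using algebra.mu_bilinear left_bilinear right_bilinear by (simp_all add: bilinear_map_iff)

lemma inv_hom:
  "inv \<alpha> (mu x y) = mu (inv \<alpha> x) (inv \<alpha> y)" "inv \<beta> (mu x y) = mu (inv \<beta> x) (inv \<beta> y)"
  "inv \<phi> (\<rho>1 x v) = \<rho>1 (inv \<alpha> x) (inv \<phi> v)" "inv \<psi> (\<rho>1 x v) = \<rho>1 (inv \<beta> x) (inv \<psi> v)"
  "inv \<phi> (\<rho>2 v x) = \<rho>2 (inv \<phi> v) (inv \<alpha> x)" "inv \<psi> (\<rho>2 v x) = \<rho>2 (inv \<psi> v) (inv \<beta> x)"
  by (metis algebra.alpha_mult algebra.beta_mult left_phi left_psi right_phi right_psi inv_cancel)+

text \<open>The inverse of the Yau twist: \<open>mu x y = m (\<alpha> x) (\<beta> y)\<close>, and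
  likewise \<open>\<rho>1 x v = l (\<alpha> x) (\<psi> v)\<close> and
  \<open>\<rho>2 v x = r (\<phi> v) (\<beta> x)\<close>.\<close>

definition m where "m x y = mu (inv \<alpha> x) (inv \<beta> y)"
definition l where "l x v = \<rho>1 (inv \<alpha> x) (inv \<psi> v)"
definition r where "r v x = \<rho>2 (inv \<phi> v) (inv \<beta> x)"

lemma untwisted_hom:
  "\<alpha> (m x y) = m (\<alpha> x) (\<alpha> y)" "\<beta> (m x y) = m (\<beta> x) (\<beta> y)"
  "\<phi> (l x v) = l (\<alpha> x) (\<phi> v)" "\<psi> (l x v) = l (\<beta> x) (\<psi> v)"
  "\<phi> (r v x) = r (\<phi> v) (\<alpha> x)" "\<psi> (r v x) = r (\<psi> v) (\<beta> x)"
  by (simp_all add: m_def l_def r_def algebra.alpha_mult algebra.beta_mult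
      left_phi left_psi right_phi right_psi commute)

lemma mu_assoc: "mu (\<alpha> x) (mu y z) = mu (mu x y) (\<beta> z)"
  using algebra.associator_zero[of x y z] by (simp add: bihom_associator_def)

sublocale untwisted: associative_bimodule m l r
proof
  \<comment> \<open>Moving the outer inverse through \<open>mu\<close> puts
    \<open>inv \<alpha>\<close> twice on \<open>x\<close>, \<open>inv \<alpha>\<close> and
    \<open>inv \<beta>\<close> on \<open>y\<close>, and \<open>inv \<beta>\<close> once on
    \<open>z\<close>. The remaining \<open>\<beta>\<close> in the twisted law dictates the second
    \<open>inv \<beta>\<close> on \<open>z\<close>. The three module laws use the same pattern, with
    \<open>\<phi>\<close> or \<open>\<psi>\<close> on the module element.\<close>
  show "m (m x y) z = m x (m y z)" for x y z
    using mu_assoc[of "inv \<alpha> (inv \<alpha> x)" "inv \<alpha> (inv \<beta> y)" "inv \<beta> (inv \<beta> z)"]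
    by (simp add: m_def inv_hom commute)
  show "l (m x y) v = l x (l y v)" for x y v
    using left_action[of "inv \<alpha> (inv \<alpha> x)" "inv \<alpha> (inv \<beta> y)" "inv \<psi> (inv \<psi> v)"]
    by (simp add: m_def l_def inv_hom commute)
  show "r (l x v) y = l x (r v y)" for x y v
    using actions_compatible[of "inv \<alpha> (inv \<alpha> x)" "inv \<phi> (inv \<psi> v)" "inv \<beta> (inv \<beta> y)"]
    by (simp add: l_def r_def inv_hom commute)
  show "r v (m x y) = r (r v x) y" for x y v
    using right_action[of "inv \<phi> (inv \<phi> v)" "inv \<alpha> (inv \<beta> x)" "inv \<beta> (inv \<beta> y)"]
    by (simp add: m_def r_def inv_hom commute)
qed (simp_all add: m_def l_def r_def bilinear additive)

section \<open>The twisted Jordan structure in untwisted form\<close>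

abbreviation "jm \<equiv> untwisted.jordan_mult"
abbreviation "ja \<equiv> untwisted.jordan_act"

abbreviation "\<rho>l \<equiv> \<lambda>x v. \<rho>1 x v + \<rho>2 (\<psi> (inv \<phi> v)) (\<alpha> (inv \<beta> x))"
abbreviation "\<rho>r \<equiv> \<lambda>v x. \<rho>1 (\<beta> (inv \<alpha> x)) (\<phi> (inv \<psi> v)) + \<rho>2 v x"

text \<open>The inverses in the second summand of \<open>plus_mult\<close> are exactly those that
  make it \<open>m (\<beta> y) (\<alpha> x)\<close>, the first summand with its factors
  swapped.\<close>

lemma plus_mult_eq: "plus_mult mu \<alpha> \<beta> x y = jm (\<alpha> x) (\<beta> y)"
  by (simp add: plus_mult_def untwisted.jordan_mult_def m_def commute)

text \<open>The summands are \<open>l (\<alpha> x) (\<psi> v)\<close> and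
  \<open>r (\<psi> v) (\<alpha> x)\<close>.\<close>

lemma left_eq: "\<rho>l x v = ja (\<alpha> x) (\<psi> v)"
  by (simp add: untwisted.jordan_act_def l_def r_def commute)

lemma right_eq: "\<rho>r v x = ja (\<beta> x) (\<phi> v)"
  by (simp add: untwisted.jordan_act_def l_def r_def commute)

lemma jordan_hom:
  "\<alpha> (jm x y) = jm (\<alpha> x) (\<alpha> y)" "\<beta> (jm x y) = jm (\<beta> x) (\<beta> y)"
  "\<phi> (ja x v) = ja (\<alpha> x) (\<phi> v)" "\<psi> (ja x v) = ja (\<beta> x) (\<psi> v)"
  by (simp_all add: untwisted.jordan_mult_def untwisted.jordan_act_def untwisted_hom additive)

lemma vector_spaces: "vector_space sA" "vector_space sV"
  by unfold_locales

lemma scale_add: "sA c (x + y) = sA c x + sA c y" "sV c (v + w) = sV c v + sV c w"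
  using vector_spaces by (simp_all add: vector_space.vector_space_assms)

text \<open>Derived from the definition of \<open>plus_mult\<close> and not through
  \<open>plus_mult_eq\<close>, as the untwisted locale carries no scalars.\<close>

lemma plus_mult_bilinear: "bilinear_map sA sA sA (plus_mult mu \<alpha> \<beta>)"
  by (simp add: bilinear_map_iff vector_spaces plus_mult_def bilinear additive homogeneous
      scale_add algebra_simps)

lemma left_bilinear_plus: "bilinear_map sA sV sV \<rho>l"
  by (simp add: bilinear_map_iff vector_spaces bilinear additive homogeneous
      scale_add algebra_simps)

lemma right_bilinear_plus: "bilinear_map sV sA sV \<rho>r"
  by (simp add: bilinear_map_iff vector_spaces bilinear additive homogeneous
      scale_add algebra_simps)

theorem jordan_bimodule: "bihom_jordan_bimodule sA (plus_mult mu \<alpha> \<beta>) \<alpha> \<beta> sV \<phi> \<psi> \<rho>l \<rho>r"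
proof
  fix x y z :: 'a and v :: 'v
  show "bihom_associator (plus_mult mu \<alpha> \<beta>) \<alpha> \<beta>
      (plus_mult mu \<alpha> \<beta> (\<beta> (\<beta> x)) (\<alpha> (\<beta> x))) (\<alpha> (\<alpha> (\<beta> y))) (\<alpha> (\<alpha> (\<alpha> x))) = 0"
    by (simp add: bihom_associator_def plus_mult_eq jordan_hom commute
        untwisted.jordan_mult_identity)
  show "cyclic_sum (\<lambda>x y z. module_associator2 \<alpha> \<beta> \<rho>l \<rho>r
         (plus_mult mu \<alpha> \<beta> (\<beta> (\<beta> x)) (\<alpha> (\<beta> y))) (\<phi> (\<phi> (\<psi> v))) (\<alpha> (\<alpha> (\<alpha> z)))) x y z = 0"
    \<comment> \<open>\<open>jordan_hom\<close> moves every structure map down to the variables.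
      Using \<open>simp only\<close> preserves the shape of the sum, so that the untwisted identity
      matches it literally.\<close>
    unfolding cyclic_sum_def module_associator2_def left_eq right_eq plus_mult_eq
    by (simp only: jordan_hom commute untwisted.jordan_act_cyclic)
  show "module_associator1 (plus_mult mu \<alpha> \<beta>) \<beta> \<phi> \<rho>r
         (\<rho>r (\<psi> (\<psi> v)) (\<beta> (\<alpha> x))) (\<beta> (\<alpha> (\<alpha> y))) (\<alpha> (\<alpha> (\<alpha> z)))
       + module_associator1 (plus_mult mu \<alpha> \<beta>) \<beta> \<phi> \<rho>r
         (\<rho>r (\<psi> (\<psi> v)) (\<beta> (\<alpha> z))) (\<beta> (\<alpha> (\<alpha> y))) (\<alpha> (\<alpha> (\<alpha> x)))
       + module_associator3 (plus_mult mu \<alpha> \<beta>) \<alpha> \<psi> \<rho>l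
         (plus_mult mu \<alpha> \<beta> (\<beta> (\<beta> x)) (\<beta> (\<alpha> z))) (\<beta> (\<alpha> (\<alpha> y))) (\<phi> (\<phi> (\<phi> v))) = 0"
    unfolding module_associator1_def module_associator3_def left_eq right_eq plus_mult_eq
    by (simp only: jordan_hom commute untwisted.jordan_act_mixed)
  show "plus_mult mu \<alpha> \<beta> (\<beta> x) (\<alpha> y) = plus_mult mu \<alpha> \<beta> (\<beta> y) (\<alpha> x)"
    by (simp add: plus_mult_eq commute untwisted.jordan_mult_commute)
  \<comment> \<open>Both sides are
    \<open>ja (\<alpha> (\<beta> x)) (\<phi> (\<psi> v))\<close>.\<close>
  show "\<rho>l (\<beta> x) (\<phi> v) = \<rho>r (\<psi> v) (\<alpha> x)"
    unfolding left_eq right_eq by (simp add: commute)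
  show "\<phi> (\<rho>l x v) = \<rho>l (\<alpha> x) (\<phi> v)" "\<psi> (\<rho>l x v) = \<rho>l (\<beta> x) (\<psi> v)"
    "\<phi> (\<rho>r v x) = \<rho>r (\<phi> v) (\<alpha> x)" "\<psi> (\<rho>r v x) = \<rho>r (\<psi> v) (\<beta> x)"
    unfolding left_eq right_eq by (simp_all add: jordan_hom commute)
qed (simp_all add: plus_mult_bilinear left_bilinear_plus right_bilinear_plus plus_mult_eq
    jordan_hom commute additive homogeneous)

end

theorem proposition4p26:
  fixes sA :: "'k::{alg_closed_field, field_char_0} \<Rightarrow> 'a::ab_group_add \<Rightarrow> 'a"
    and mu :: "'a \<Rightarrow> 'a \<Rightarrow> 'a" and \<alpha> \<beta> :: "'a \<Rightarrow> 'a"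
    and sV :: "'k \<Rightarrow> 'v::ab_group_add \<Rightarrow> 'v" and \<phi> \<psi> :: "'v \<Rightarrow> 'v"
    and \<rho>1 :: "'a \<Rightarrow> 'v \<Rightarrow> 'v" and \<rho>2 :: "'v \<Rightarrow> 'a \<Rightarrow> 'v"
  assumes "regular_bihom_associative_algebra sA mu \<alpha> \<beta>"
    and "bihom_associative_bimodule sA mu \<alpha> \<beta> sV \<phi> \<psi> \<rho>1 \<rho>2"
    and "bij \<phi>" and "bij \<psi>"
  shows "bihom_jordan_bimodule sA (plus_mult mu \<alpha> \<beta>) \<alpha> \<beta> sV \<phi> \<psi>
           (\<lambda>x v. \<rho>1 x v + \<rho>2 (\<psi> (inv \<phi> v)) (\<alpha> (inv \<beta> x)))
           (\<lambda>v x. \<rho>1 (\<beta> (inv \<alpha> x)) (\<phi> (inv \<psi> v)) + \<rho>2 v x)"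
  using assms
  by (intro invertible_bihom_associative_bimodule.jordan_bimodule
      invertible_bihom_associative_bimodule.intro
      invertible_bihom_associative_bimodule_axioms.intro)

end
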